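(* Let $G$ be a graph and let $M$ be a maximum matching in $G$. Suppose that for all vertices $u,u',v,v'$ of $G$ with $uu'\in M$ and $vv'\in M$, if $uv\in E(G)$ then $u'v'\in E(G)$. Then $\alpha'_g(G)=\hat\alpha'_g(G)=\alpha'(G)$.
   Context: Graphs are finite and simple. $\alpha'(G)$ denotes the maximum size of a matching in $G$. The matching game on a graph $G$: two players, Max and Min, alternately add edges of $G$ to a set of chosen edges that must always remain a matching; the game ends when the chosen edges form a maximal matching of $G$ (no further edge can be added). Max wants the final matching to be large, Min wants it to be small. $\alpha'_g(G)$ denotes the size of the final matching under optimal play when Max moves first, and $\hat\alpha'_g(G)$ denotes the size of the final matching under optimal play when Min moves first. *)

theory Defs
  imports Main "HOL-Library.Disjoint_Sets"
begin

definition finite_simple_graph :: "'a set \<Rightarrow> 'a set set \<Rightarrow> bool" where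
  "finite_simple_graph V E \<longleftrightarrow> finite V \<and> (\<forall>e\<in>E. e \<subseteq> V \<and> card e = 2)"

definition is_matching :: "'a set set \<Rightarrow> 'a set set \<Rightarrow> bool" where
  "is_matching E M \<longleftrightarrow> M \<subseteq> E \<and> disjoint M"

definition matching_number :: "'a set set \<Rightarrow> nat" where
  "matching_number E = Max (card ` {M. is_matching E M})"

definition maximum_matching :: "'a set set \<Rightarrow> 'a set set \<Rightarrow> bool" where
  "maximum_matching E M \<longleftrightarrow> is_matching E M \<and> card M = matching_number E"

definition legal_moves :: "'a set set \<Rightarrow> 'a set set \<Rightarrow> 'a set set" where
  "legal_moves E A = {e \<in> E - A. is_matching E (insert e A)}"

lemma card_legal_move_less:
  assumes "finite E" "e \<in> legal_moves E A"
  shows "card (E - insert e A) < card (E - A)"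
proof (rule psubset_card_mono)
  show "finite (E - A)" using assms(1) by simp
  show "E - insert e A \<subset> E - A" using assms(2) unfolding legal_moves_def by blast
qed

datatype player = Player_Max | Player_Min

fun opponent :: "player \<Rightarrow> player" where
  "opponent Player_Max = Player_Min"
| "opponent Player_Min = Player_Max"

text \<open>
  The size of the final matching under optimal play (by backward induction) when the
  edges in \<open>A\<close> have already been chosen and player \<open>p\<close> is to move. For a matching \<open>A\<close>,
  there is no legal move exactly when \<open>A\<close> is a maximal matching.
  The case of infinitely many edges is there only to make the function total.
\<close>

function game_value :: "'a set set \<Rightarrow> player \<Rightarrow> 'a set set \<Rightarrow> nat" where
  "game_value E p A =
     (if infinite E \<or> legal_moves E A = {} then card A
      else (case p of
              Player_Max \<Rightarrow> Max ((\<lambda>e. game_value E (opponent p) (insert e A)) ` legal_moves E A)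
            | Player_Min \<Rightarrow> Min ((\<lambda>e. game_value E (opponent p) (insert e A)) ` legal_moves E A)))"
  by pat_completeness auto
termination
  by (relation "measure (\<lambda>(E, p, A). card (E - A))")
    (auto dest: card_legal_move_less simp del: card_Diff_insert)

declare game_value.simps [simp del]

definition max_start_game_number :: "'a set set \<Rightarrow> nat" where
  "max_start_game_number E = game_value E Player_Max {}"

definition min_start_game_number :: "'a set set \<Rightarrow> nat" where
  "min_start_game_number E = game_value E Player_Min {}"

end

theory Submission
  imports Defs
begin

text \<open>
  Max maintains the invariant that the chosen edges \<open>A\<close> together with a set \<open>N \<subseteq> M\<close> of unplayed
  edges form a maximum matching. On his own move he plays an edge of \<open>N\<close>. A move \<open>uv\<close> of Min
  that meets only one edge of \<open>N\<close> simply replaces that edge. If it meets two, \<open>uu'\<close> and \<open>vv'\<close>,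
  then by hypothesis Max can answer \<open>u'v'\<close>, and the two new edges replace \<open>uu'\<close> and \<open>vv'\<close>.
\<close>

section \<open>Edges and matchings of a finite simple graph\<close>

lemma finite_edges: "finite_simple_graph V E \<Longrightarrow> finite E"
  unfolding finite_simple_graph_def by (meson PowI finite_Pow_iff finite_subset subsetI)

lemma card_edge: "finite_simple_graph V E \<Longrightarrow> e \<in> E \<Longrightarrow> card e = 2"
  unfolding finite_simple_graph_def by blast

lemma edge_nonempty: "finite_simple_graph V E \<Longrightarrow> e \<in> E \<Longrightarrow> e \<noteq> {}"
  using card_edge by fastforce

lemma finite_is_matching: "finite E \<Longrightarrow> is_matching E B \<Longrightarrow> finite B"
  unfolding is_matching_def by (auto intro: finite_subset)

lemma card_matching_le:
  assumes "finite E" "is_matching E B"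
  shows "card B \<le> matching_number E"
  unfolding matching_number_def
proof (rule Max_ge)
  have "{M. is_matching E M} \<subseteq> Pow E" by (auto simp: is_matching_def)
  then show "finite (card ` {M. is_matching E M})"
    using assms(1) by (meson finite_Pow_iff finite_imageI finite_subset)
qed (use assms in auto)

text \<open>The guard \<open>f \<noteq> e\<close> keeps the equivalence valid when \<open>e\<close>
  already belongs to \<open>B\<close>.\<close>

lemma is_matching_insert:
  "is_matching E (insert e B) \<longleftrightarrow> e \<in> E \<and> is_matching E B \<and> (\<forall>f\<in>B. f \<noteq> e \<longrightarrow> e \<inter> f = {})"
proof
  assume "is_matching E (insert e B)"
  then show "e \<in> E \<and> is_matching E B \<and> (\<forall>f\<in>B. f \<noteq> e \<longrightarrow> e \<inter> f = {})"
    unfolding is_matching_def disjoint_def by (metis insertCI insert_subset)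
next
  assume "e \<in> E \<and> is_matching E B \<and> (\<forall>f\<in>B. f \<noteq> e \<longrightarrow> e \<inter> f = {})"
  then show "is_matching E (insert e B)"
    unfolding is_matching_def disjoint_def by (metis Int_commute insertE insert_subset)
qed

lemma is_matching_subset: "is_matching E B \<Longrightarrow> C \<subseteq> B \<Longrightarrow> is_matching E C"
  unfolding is_matching_def disjoint_def by blast

lemma is_matchingD: "is_matching E B \<Longrightarrow> f \<in> B \<Longrightarrow> g \<in> B \<Longrightarrow> f \<noteq> g \<Longrightarrow> f \<inter> g = {}"
  unfolding is_matching_def disjoint_def by blast

section \<open>Legal moves and general bounds on the game value\<close>

lemma legal_movesI:
  assumes "finite_simple_graph V E" "is_matching E A" "e \<in> E" "\<forall>f\<in>A. e \<inter> f = {}"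
  shows "e \<in> legal_moves E A"
  \<comment> \<open>If \<open>e\<close> were in \<open>A\<close>, it would be disjoint from itself,
    but edges are nonempty; hence \<open>e\<close> is new.\<close>
  using assms edge_nonempty[OF assms(1,3)] unfolding legal_moves_def is_matching_insert by auto

lemma legal_movesD:
  assumes "e \<in> legal_moves E A"
  shows "e \<in> E" "e \<notin> A" "is_matching E (insert e A)" "\<forall>f\<in>A. e \<inter> f = {}"
  using assms unfolding legal_moves_def is_matching_insert by auto

lemma finite_legal_moves: "finite E \<Longrightarrow> finite (legal_moves E A)"
  unfolding legal_moves_def by simp

lemma game_value_no_moves: "legal_moves E A = {} \<Longrightarrow> game_value E p A = card A"
  by (simp add: game_value.simps)

lemma game_value_Max_ge:
  assumes "finite E" "e \<in> legal_moves E A"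
  shows "game_value E Player_Min (insert e A) \<le> game_value E Player_Max A"
proof -
  have "game_value E Player_Max A =
      Max ((\<lambda>e. game_value E Player_Min (insert e A)) ` legal_moves E A)"
    using assms by (subst game_value.simps) auto
  then show ?thesis using assms finite_legal_moves[OF assms(1)] by (auto intro: Max_ge)
qed

text \<open>A maximum or minimum over a finite nonempty set is attained. This yields an optimal move
  of either player without distinguishing who moves.\<close>

lemma game_value_in_successors:
  assumes "finite E" "legal_moves E A \<noteq> {}"
  shows "\<exists>e\<in>legal_moves E A. game_value E p A = game_value E (opponent p) (insert e A)"
proof -
  let ?S = "(\<lambda>e. game_value E (opponent p) (insert e A)) ` legal_moves E A"
  have "finite ?S" "?S \<noteq> {}" using assms finite_legal_moves by auto
  then have "Max ?S \<in> ?S" "Min ?S \<in> ?S" using Max_in Min_in by blast+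
  moreover have "game_value E p A = Max ?S \<or> game_value E p A = Min ?S"
    using assms by (subst (1 2) game_value.simps) (auto split: player.splits)
  ultimately show ?thesis by auto
qed

text \<open>Every line of play ends in a matching, so the bound passes back from the final position
  along optimal moves, whoever makes them.\<close>

lemma game_value_le:
  assumes "finite E" "is_matching E A"
  shows "game_value E p A \<le> matching_number E"
  using assms(2)
proof (induction "card (E - A)" arbitrary: A p rule: less_induct)
  case less
  show ?case
  proof (cases "legal_moves E A = {}")
    case True
    then show ?thesis using less.prems card_matching_le assms(1) by (simp add: game_value_no_moves)
  next
    case False
    then obtain e where e: "e \<in> legal_moves E A"
      "game_value E p A = game_value E (opponent p) (insert e A)"
      using game_value_in_successors[OF assms(1)] by blast
    then show ?thesis
      using less.hyps[OF card_legal_move_less[OF assms(1) e(1)]] legal_movesD(3) by metis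
  qed
qed

section \<open>Exchanges that keep a maximum matching, and the lower bound\<close>

lemma unplayed_edge_legal:
  assumes "finite_simple_graph V E" "is_matching E (A \<union> N)" "A \<inter> N = {}" "n \<in> N"
  shows "n \<in> legal_moves E A"
proof (rule legal_movesI[OF assms(1)])
  show "is_matching E A" using assms(2) is_matching_subset by blast
  show "n \<in> E" using assms(2,4) unfolding is_matching_def by blast
  show "\<forall>f\<in>A. n \<inter> f = {}" using is_matchingD[OF assms(2)] assms(3,4) by blast
qed

text \<open>Edges of \<open>N\<close> are themselves playable; once \<open>N\<close> is empty,
  \<open>A\<close> is a maximum matching and a further move would enlarge it. So under the invariant
  the game ends exactly when \<open>N\<close> is used up.\<close>

lemma no_legal_moves_iff:
  assumes "finite_simple_graph V E" "A \<inter> N = {}" "maximum_matching E (A \<union> N)"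
  shows "legal_moves E A = {} \<longleftrightarrow> N = {}"
proof -
  have fin: "finite E" using assms(1) finite_edges by blast
  have mat: "is_matching E (A \<union> N)" and num: "card (A \<union> N) = matching_number E"
    using assms(3) unfolding maximum_matching_def by auto
  have "n \<in> legal_moves E A" if "n \<in> N" for n
    using unplayed_edge_legal[OF assms(1) mat assms(2) that] .
  moreover have "e \<notin> legal_moves E A" if "N = {}" for e
  proof
    assume e: "e \<in> legal_moves E A"
    have "card (insert e A) = Suc (matching_number E)"
      using num that legal_movesD(2)[OF e] finite_is_matching[OF fin mat] by simp
    then show False using card_matching_le[OF fin legal_movesD(3)[OF e]] by simp
  qed
  ultimately show ?thesis by blast
qed

text \<open>Apart from \<open>f\<close>, every edge of \<open>A \<union> N\<close> is disjoint from
  \<open>e\<close>, so \<open>e\<close> takes the place of \<open>f\<close> one for one. The case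
  \<open>e = f\<close> is Max's own move, which transfers an edge from \<open>N\<close> to
  \<open>A\<close>.\<close>

lemma maximum_matching_exchange:
  assumes "finite_simple_graph V E" "maximum_matching E (A \<union> N)" "A \<inter> N = {}"
    and "f \<in> N" "e \<in> legal_moves E A" "\<forall>g\<in>N - {f}. e \<inter> g = {}"
  shows "insert e A \<inter> (N - {f}) = {}" "maximum_matching E (insert e A \<union> (N - {f}))"
proof -
  note e = legal_movesD[OF assms(5)]
  have fin: "finite E" using assms(1) finite_edges by blast
  have mat: "is_matching E (A \<union> N)" and num: "card (A \<union> N) = matching_number E"
    using assms(2) unfolding maximum_matching_def by auto
  have e_new: "e \<notin> A \<union> (N - {f})" using e(2) assms(6) edge_nonempty[OF assms(1) e(1)] by auto
  then show "insert e A \<inter> (N - {f}) = {}" using assms(3) by blast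
  have "is_matching E (insert e (A \<union> (N - {f})))"
    unfolding is_matching_insert using e(1,4) assms(6) is_matching_subset[OF mat, of "A \<union> (N - {f})"] by auto
  moreover have "card (insert e (A \<union> (N - {f}))) = card (A \<union> N)"
  proof -
    have finU: "finite (A \<union> N)" using finite_is_matching[OF fin mat] .
    have "card (insert e (A \<union> (N - {f}))) = Suc (card (A \<union> (N - {f})))"
      using e_new finU by (intro card_insert_disjoint) auto
    also have "\<dots> = Suc (card ((A \<union> N) - {f}))"
      using assms(3,4) by (intro arg_cong[of _ _ "\<lambda>X. Suc (card X)"]) auto
    also have "\<dots> = card (A \<union> N)"
      using finU assms(4) by (intro card_Suc_Diff1) auto
    finally show ?thesis .
  qed
  ultimately show "maximum_matching E (insert e A \<union> (N - {f}))"
    using num unfolding maximum_matching_def by simp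
qed

lemma edge_obtain_other:
  assumes "card f = 2" "u \<in> f"
  obtains u' where "f = {u, u'}" "u' \<noteq> u"
  using assms unfolding card_2_iff by blast

text \<open>The disjoint edges \<open>e\<close> and \<open>e'\<close> live on the vertices of
  \<open>f\<close> and \<open>g\<close>, which the other edges of \<open>A \<union> N\<close> avoid,
  so two edges are traded for two.\<close>

lemma maximum_matching_exchange2:
  assumes "finite_simple_graph V E" "maximum_matching E (A \<union> N)" "A \<inter> N = {}"
    and fg: "f \<in> N" "g \<in> N" "f \<noteq> g"
    and e: "e \<in> legal_moves E A" "e \<subseteq> f \<union> g"
    and e': "e' \<in> E" "e' \<subseteq> f \<union> g" "e' \<inter> e = {}"
  shows "e' \<in> legal_moves E (insert e A)"
    "insert e' (insert e A) \<inter> (N - {f, g}) = {}"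
    "maximum_matching E (insert e' (insert e A) \<union> (N - {f, g}))"
proof -
  let ?R = "N - {f, g}" and ?B = "insert e' (insert e A)"
  have fin: "finite E" using assms(1) finite_edges by blast
  have mat: "is_matching E (A \<union> N)" and num: "card (A \<union> N) = matching_number E"
    using assms(2) unfolding maximum_matching_def by auto
  note eE = legal_movesD(1)[OF e(1)]
  have disj: "e \<inter> h = {}" "e' \<inter> h = {}" if h: "h \<in> A \<union> ?R" for h
  proof -
    have "f \<noteq> h" "g \<noteq> h" using h fg assms(3) by auto
    then have "f \<inter> h = {}" "g \<inter> h = {}" using h fg is_matchingD[OF mat] by (meson DiffD1 UnCI UnE)+
    then show "e \<inter> h = {}" "e' \<inter> h = {}" using e(2) e'(2) by blast+
  qed
  show "e' \<in> legal_moves E (insert e A)"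
    using legal_movesI[OF assms(1) legal_movesD(3)[OF e(1)] e'(1)] e'(3) disj(2) by blast
  \<comment> \<open>Membership would make a nonempty edge disjoint from itself. Newness of both
    edges is what makes the cardinality count below exact.\<close>
  have new: "e \<notin> A \<union> ?R" "e' \<notin> insert e (A \<union> ?R)"
    using disj[of e] disj[of e'] e'(3) edge_nonempty[OF assms(1)] eE e'(1) by auto
  then show "?B \<inter> ?R = {}" using assms(3) by blast
  have "is_matching E (insert e' (insert e (A \<union> ?R)))"
    unfolding is_matching_insert
    using eE e' disj is_matching_subset[OF mat, of "A \<union> ?R"] by blast
  then have B: "is_matching E (?B \<union> ?R)" by simp
  have finR: "finite (A \<union> ?R)" using finite_is_matching[OF fin mat] by simp
  have "A \<union> N = insert f (insert g (A \<union> ?R))" using fg by blast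
  moreover have "g \<notin> A \<union> ?R" "f \<notin> insert g (A \<union> ?R)" using fg assms(3) by blast+
  ultimately have "card (A \<union> N) = Suc (Suc (card (A \<union> ?R)))"
    using finR by (metis card_insert_disjoint finite_insert)
  moreover have "card (?B \<union> ?R) = Suc (Suc (card (A \<union> ?R)))"
    using new finR by (metis Un_insert_left card_insert_disjoint finite_insert)
  ultimately show "maximum_matching E (?B \<union> ?R)"
    using num B unfolding maximum_matching_def by simp
qed

text \<open>Strong induction on the number of unchosen edges, for both players at once: when Min's
  move meets two edges of \<open>N\<close>, the invariant may fail right after it and is restored
  only by Max's reply, so the induction hypothesis is applied two moves later.\<close>

lemma game_value_ge:
  assumes G: "finite_simple_graph V E"
    and swap: "\<forall>u\<in>V. \<forall>u'\<in>V. \<forall>v\<in>V. \<forall>v'\<in>V.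
           {u, u'} \<in> M \<longrightarrow> {v, v'} \<in> M \<longrightarrow> {u, v} \<in> E \<longrightarrow> {u', v'} \<in> E"
    and "N \<subseteq> M" "A \<inter> N = {}" "maximum_matching E (A \<union> N)"
  shows "matching_number E \<le> game_value E p A"
  using assms(3-)
proof (induction "card (E - A)" arbitrary: A N p rule: less_induct)
  case less
  note N = \<open>N \<subseteq> M\<close> and AN = \<open>A \<inter> N = {}\<close> and max = \<open>maximum_matching E (A \<union> N)\<close>
  have fin: "finite E" using G finite_edges by blast
  have mat: "is_matching E (A \<union> N)" and num: "card (A \<union> N) = matching_number E"
    using max unfolding maximum_matching_def by auto
  note moves = no_legal_moves_iff[OF G AN max]
  \<comment> \<open>The one-move case, shared by Max's moves inside \<open>N\<close> and by Min's
    moves that meet at most one edge of \<open>N\<close>.\<close>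
  have one: "matching_number E \<le> game_value E q (insert e A)"
    if "e \<in> legal_moves E A" "f \<in> N" "\<forall>g\<in>N - {f}. e \<inter> g = {}" for q e f
    using less.hyps[OF card_legal_move_less[OF fin that(1)], of "N - {f}"]
      maximum_matching_exchange[OF G max AN that(2,1,3)] N by blast
  show ?case
  proof (cases "N = {}")
    case True
    then show ?thesis using moves num by (simp add: game_value_no_moves)
  next
    case False
    then obtain n where n: "n \<in> N" by blast
    show ?thesis
    proof (cases p)
      case Player_Max
      have "n \<in> legal_moves E A" using unplayed_edge_legal[OF G mat AN n] .
      moreover have "\<forall>g\<in>N - {n}. n \<inter> g = {}" using is_matchingD[OF mat] n by blast
      ultimately show ?thesis
        using one[of n n] n game_value_Max_ge[OF fin, of n A] Player_Max by (meson order_trans)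
    next
      case Player_Min
      \<comment> \<open>Take \<open>e\<close> to be an optimal move of Min; it suffices to bound the
        value after it.\<close>
      obtain e where e: "e \<in> legal_moves E A"
        and val: "game_value E p A = game_value E Player_Max (insert e A)"
        using game_value_in_successors[OF fin, of A p] moves False Player_Min by auto
      have eE: "e \<in> E" using e legal_movesD(1) by blast
      show ?thesis
      proof (cases "\<exists>f\<in>N. \<forall>g\<in>N - {f}. e \<inter> g = {}")
        case True
        then show ?thesis using one e val by metis
      next
        case many: False
        \<comment> \<open>No single edge of \<open>N\<close> can be left out to make
          \<open>e\<close> disjoint from the rest. Leaving out \<open>n\<close> yields
          \<open>f\<close>; leaving out \<open>f\<close> then yields a second edge
          \<open>g\<close>.\<close>
        then obtain f where f: "f \<in> N" "e \<inter> f \<noteq> {}" using n by blast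
        then obtain g where g: "g \<in> N" "f \<noteq> g" "e \<inter> g \<noteq> {}" using many by blast
        obtain u v where uv: "u \<in> e" "u \<in> f" "v \<in> e" "v \<in> g" using f g by blast
        have fg_disj: "f \<inter> g = {}" using is_matchingD[OF mat] f g by blast
        then have "u \<noteq> v" using uv by blast
        then have e_eq: "e = {u, v}"
          using edge_obtain_other[OF card_edge[OF G eE] uv(1)] uv(3) by blast
        have fgE: "f \<in> E" "g \<in> E" using mat f g unfolding is_matching_def by auto
        obtain u' where u': "f = {u, u'}" "u' \<noteq> u"
          using edge_obtain_other[OF card_edge[OF G fgE(1)] uv(2)] by blast
        obtain v' where v': "g = {v, v'}" "v' \<noteq> v"
          using edge_obtain_other[OF card_edge[OF G fgE(2)] uv(4)] by blast
        have "f \<subseteq> V" "g \<subseteq> V" using fgE G unfolding finite_simple_graph_def by auto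
        then have "u \<in> V" "u' \<in> V" "v \<in> V" "v' \<in> V" using u'(1) v'(1) by auto
        moreover have "{u, u'} \<in> M" "{v, v'} \<in> M" using f(1) g(1) N u'(1) v'(1) by auto
        \<comment> \<open>The hypothesis on \<open>M\<close> applies because
          \<open>N \<subseteq> M\<close>: this edge joins the ends of \<open>f\<close> and
          \<open>g\<close> missed by \<open>e\<close>, and is Max's reply.\<close>
        ultimately have e'E: "{u', v'} \<in> E" using swap eE e_eq by metis
        have sub: "e \<subseteq> f \<union> g" "{u', v'} \<subseteq> f \<union> g" using e_eq u'(1) v'(1) by auto
        have "{u', v'} \<inter> e = {}" using fg_disj e_eq u' v' by auto
        note ex = maximum_matching_exchange2[OF G max AN f(1) g(1,2) e sub(1) e'E sub(2) this]
        have "card (E - insert {u', v'} (insert e A)) < card (E - A)"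
          using card_legal_move_less[OF fin ex(1)] card_legal_move_less[OF fin e] by (rule less_trans)
        moreover have "N - {f, g} \<subseteq> M" using N by blast
        ultimately have "matching_number E \<le> game_value E Player_Min (insert {u', v'} (insert e A))"
          using less.hyps ex(2,3) by metis
        \<comment> \<open>Max's optimal reply to \<open>e\<close> is at least as good as
          \<open>{u', v'}\<close>.\<close>
        then show ?thesis using game_value_Max_ge[OF fin ex(1)] val by simp
      qed
    qed
  qed
qed

theorem theorem3p1:
  fixes V :: "'a set" and E M :: "'a set set"
  assumes "finite_simple_graph V E"
    and "maximum_matching E M"
    and "\<forall>u\<in>V. \<forall>u'\<in>V. \<forall>v\<in>V. \<forall>v'\<in>V.
           {u, u'} \<in> M \<longrightarrow> {v, v'} \<in> M \<longrightarrow> {u, v} \<in> E \<longrightarrow> {u', v'} \<in> E"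
  shows "max_start_game_number E = min_start_game_number E
       \<and> min_start_game_number E = matching_number E"
proof -
  have "game_value E p {} = matching_number E" for p
  proof (rule antisym)
    show "game_value E p {} \<le> matching_number E"
      using game_value_le[OF finite_edges[OF assms(1)]] by (simp add: is_matching_def)
    show "matching_number E \<le> game_value E p {}"
      \<comment> \<open>At the start nothing is chosen and all of \<open>M\<close> is unplayed, so
        the invariant holds with \<open>N = M\<close>.\<close>
      using game_value_ge[OF assms(1,3), of M "{}"] assms(2) by simp
  qed
  then show ?thesis unfolding max_start_game_number_def min_start_game_number_def by simp
qed

end
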